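(* Consider the Lagrangian density $$\mathcal{L}^{2HS}=u_tu_x+uu_x^2+r_tr_x+ur_x^2$$ for real-valued functions $u=u(t,x)$ and $r=r(t,x)$. With $\rho=r_x$, the Euler--Lagrange equations (with respect to $u$ and $r$) for $\mathcal{L}^{2HS}$ are the two-component Hunter--Saxton system $$(u_t+uu_x)_x=\tfrac12u_x^2+\tfrac12\rho^2,\qquad \rho_t+(u\rho)_x=0 .$$
   Context: For a Lagrangian density $\mathcal{L}(u,u_t,u_x,r,r_t,r_x)$ in the independent variables $(t,x)\in\mathbb{R}^2$, the Euler--Lagrange equations are $\frac{\partial\mathcal{L}}{\partial u}-\partial_t\frac{\partial\mathcal{L}}{\partial u_t}-\partial_x\frac{\partial\mathcal{L}}{\partial u_x}=0$ and $\frac{\partial\mathcal{L}}{\partial r}-\partial_t\frac{\partial\mathcal{L}}{\partial r_t}-\partial_x\frac{\partial\mathcal{L}}{\partial r_x}=0$. Equations are understood up to multiplication by nonzero constants, for sufficiently smooth ($C^2$) functions $u,r$. *)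

theory Defs
  imports "HOL-Analysis.Analysis"
begin

text \<open>
  A field is a curried function of the independent variables \<open>t\<close> and \<open>x\<close>, in this order.
\<close>

type_synonym field = "real \<Rightarrow> real \<Rightarrow> real"

definition dt :: "field \<Rightarrow> field" where
  "dt f = (\<lambda>t x. deriv (\<lambda>s. f s x) t)"

definition dx :: "field \<Rightarrow> field" where
  "dx f = (\<lambda>t x. deriv (\<lambda>y. f t y) x)"

text \<open>Existence of the partial derivatives is required separately because \<open>deriv\<close> is total.\<close>

definition C1 :: "field \<Rightarrow> bool" where
  "C1 f \<longleftrightarrow>
     (\<forall>t x. (\<lambda>s. f s x) field_differentiable at t) \<and>
     (\<forall>t x. (\<lambda>y. f t y) field_differentiable at x) \<and>
     continuous_on UNIV (\<lambda>(t, x). dt f t x) \<and>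
     continuous_on UNIV (\<lambda>(t, x). dx f t x)"

definition C2 :: "field \<Rightarrow> bool" where
  "C2 f \<longleftrightarrow> C1 f \<and> C1 (dt f) \<and> C1 (dx f)"

text \<open>
  The arguments of a Lagrangian density are, in this order,
  \<open>u\<close>, \<open>u\<^sub>t\<close>, \<open>u\<^sub>x\<close>, \<open>r\<close>, \<open>r\<^sub>t\<close>, \<open>r\<^sub>x\<close>, treated as independent real variables.
\<close>

type_synonym lagrangian = "real \<Rightarrow> real \<Rightarrow> real \<Rightarrow> real \<Rightarrow> real \<Rightarrow> real \<Rightarrow> real"

definition along :: "lagrangian \<Rightarrow> field \<Rightarrow> field \<Rightarrow> field" where
  "along L u r = (\<lambda>t x. L (u t x) (dt u t x) (dx u t x) (r t x) (dt r t x) (dx r t x))"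

definition L_u :: "lagrangian \<Rightarrow> lagrangian" where
  "L_u L = (\<lambda>u ut ux r rt rx. deriv (\<lambda>z. L z ut ux r rt rx) u)"

definition L_ut :: "lagrangian \<Rightarrow> lagrangian" where
  "L_ut L = (\<lambda>u ut ux r rt rx. deriv (\<lambda>z. L u z ux r rt rx) ut)"

definition L_ux :: "lagrangian \<Rightarrow> lagrangian" where
  "L_ux L = (\<lambda>u ut ux r rt rx. deriv (\<lambda>z. L u ut z r rt rx) ux)"

definition L_r :: "lagrangian \<Rightarrow> lagrangian" where
  "L_r L = (\<lambda>u ut ux r rt rx. deriv (\<lambda>z. L u ut ux z rt rx) r)"

definition L_rt :: "lagrangian \<Rightarrow> lagrangian" where
  "L_rt L = (\<lambda>u ut ux r rt rx. deriv (\<lambda>z. L u ut ux r z rx) rt)"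

definition L_rx :: "lagrangian \<Rightarrow> lagrangian" where
  "L_rx L = (\<lambda>u ut ux r rt rx. deriv (\<lambda>z. L u ut ux r rt z) rx)"

text \<open>Left-hand sides of the Euler--Lagrange equations with respect to \<open>u\<close> and \<open>r\<close>.\<close>

definition EL_u :: "lagrangian \<Rightarrow> field \<Rightarrow> field \<Rightarrow> field" where
  "EL_u L u r = (\<lambda>t x.
     along (L_u L) u r t x - dt (along (L_ut L) u r) t x - dx (along (L_ux L) u r) t x)"

definition EL_r :: "lagrangian \<Rightarrow> field \<Rightarrow> field \<Rightarrow> field" where
  "EL_r L u r = (\<lambda>t x.
     along (L_r L) u r t x - dt (along (L_rt L) u r) t x - dx (along (L_rx L) u r) t x)"

definition L_2HS :: lagrangian where
  "L_2HS = (\<lambda>u ut ux r rt rx. ut * ux + u * ux\<^sup>2 + rt * rx + u * rx\<^sup>2)"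

end

theory Submission
  imports Defs
begin

text \<open>
  The density is polynomial in its six arguments, so its partial derivatives are elementary, and
  expanding the total derivatives with the product rule gives
  \<open>EL\<^sub>u = - u\<^sub>x\<^sub>t - u\<^sub>t\<^sub>x - 2 u u\<^sub>x\<^sub>x - u\<^sub>x\<^sup>2 + \<rho>\<^sup>2\<close> and \<open>EL\<^sub>r = - r\<^sub>x\<^sub>t - r\<^sub>t\<^sub>x - 2 (u \<rho>)\<^sub>x\<close>.
  The two equations of the system, expanded in the same way, contain only one of the two mixed
  derivatives each. For \<open>C\<^sup>2\<close> fields the mixed derivatives coincide, and then both Euler--Lagrange
  expressions are \<open>-2\<close> times the corresponding equation.

  The only analytic ingredient is therefore the symmetry of the mixed derivatives
  (\<open>mixed_partials_eq\<close>, \<open>dt_dx_commute\<close>). It is obtained from the second difference of the function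
  over a small square, which is symmetric in the two variables and which the mean value theorem
  expresses by either mixed derivative at a point of the square.
\<close>

text \<open>
  Applying the mean value theorem to \<open>f\<close> at the heights \<open>x\<close> and \<open>x + h\<close> separately would give two
  unrelated intermediate points. Applying it to the difference of the two slices gives a single
  \<open>s\<close>, so that a second application, to \<open>p s\<close>, is possible.
\<close>

lemma second_difference_mvt:
  fixes f p g :: "real \<Rightarrow> real \<Rightarrow> real"
  assumes f: "\<And>s y. ((\<lambda>s. f s y) has_real_derivative p s y) (at s)"
    and p: "\<And>s y. (p s has_real_derivative g s y) (at y)"
    and h: "h > 0"
  obtains s y where "t < s" "s < t + h" "x < y" "y < x + h"
    "f (t + h) (x + h) - f (t + h) x - f t (x + h) + f t x = h\<^sup>2 * g s y"
proof -
  have "\<exists>s>t. s < t + h \<and>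
      (f (t + h) (x + h) - f (t + h) x) - (f t (x + h) - f t x)
        = (t + h - t) * (p s (x + h) - p s x)"
    by (rule MVT2[of t "t + h" "\<lambda>s. f s (x + h) - f s x" "\<lambda>s. p s (x + h) - p s x"])
      (use h in \<open>auto intro!: DERIV_diff f\<close>)
  then obtain s where s: "t < s" "s < t + h"
    "(f (t + h) (x + h) - f (t + h) x) - (f t (x + h) - f t x) = h * (p s (x + h) - p s x)"
    by auto
  have "\<exists>y>x. y < x + h \<and> p s (x + h) - p s x = (x + h - x) * g s y"
    by (rule MVT2) (use h in \<open>auto intro!: p\<close>)
  then obtain y where y: "x < y" "y < x + h" "p s (x + h) - p s x = h * g s y"
    by auto
  show thesis
    by (rule that[OF s(1,2) y(1,2)]) (use s(3) y(3) in \<open>simp add: power2_eq_square\<close>)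
qed

text \<open>
  Both mixed derivatives equal the second difference divided by \<open>h\<^sup>2\<close>, each at some point of the
  square of side \<open>h\<close>; continuity at the corner transfers this equality to the limit \<open>h \<rightarrow> 0\<close>.
\<close>

lemma mixed_partials_eq:
  fixes f p q g k :: "real \<Rightarrow> real \<Rightarrow> real"
  assumes fp: "\<And>s y. ((\<lambda>s. f s y) has_real_derivative p s y) (at s)"
    and pg: "\<And>s y. (p s has_real_derivative g s y) (at y)"
    and fq: "\<And>s y. (f s has_real_derivative q s y) (at y)"
    and qk: "\<And>s y. ((\<lambda>s. q s y) has_real_derivative k s y) (at s)"
    and g: "isCont (\<lambda>(s, y). g s y) (t, x)"
    and k: "isCont (\<lambda>(s, y). k s y) (t, x)"
  shows "g t x = k t x"
proof (rule ccontr)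
  assume neq: "g t x \<noteq> k t x"
  define e where "e = dist (g t x) (k t x) / 2"
  have e: "e > 0" using neq by (simp add: e_def)
  obtain d1 where d1: "d1 > 0" "\<And>z. dist z (t, x) < d1 \<Longrightarrow> dist (case z of (s, y) \<Rightarrow> g s y) (g t x) < e"
    using g e unfolding continuous_at_eps_delta by (metis case_prod_conv)
  obtain d2 where d2: "d2 > 0" "\<And>z. dist z (t, x) < d2 \<Longrightarrow> dist (case z of (s, y) \<Rightarrow> k s y) (k t x) < e"
    using k e unfolding continuous_at_eps_delta by (metis case_prod_conv)
  \<comment> \<open>The distance of a point of the square to its corner is at most \<open>2 * h\<close>.\<close>
  define h where "h = min d1 d2 / 2"
  have h: "h > 0" using d1 d2 by (simp add: h_def)
  have near: "dist (s, y) (t, x) < min d1 d2"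
    if "t < s" "s < t + h" "x < y" "y < x + h" for s y
  proof -
    have "dist (s, y) (t, x) \<le> \<bar>s - t\<bar> + \<bar>y - x\<bar>"
      unfolding dist_Pair_Pair dist_real_def
      using sqrt_sum_squares_le_sum_abs[of "\<bar>s - t\<bar>" "\<bar>y - x\<bar>"] by simp
    also have "\<dots> < min d1 d2" using that unfolding h_def by linarith
    finally show ?thesis .
  qed
  obtain s y where sy: "t < s" "s < t + h" "x < y" "y < x + h"
    "f (t + h) (x + h) - f (t + h) x - f t (x + h) + f t x = h\<^sup>2 * g s y"
    using second_difference_mvt[where f = f and p = p and g = g, OF fp pg h] by blast
  \<comment> \<open>The same square with the two variables exchanged.\<close>
  obtain y' s' where sy': "x < y'" "y' < x + h" "t < s'" "s' < t + h"
    "f (t + h) (x + h) - f t (x + h) - f (t + h) x + f t x = h\<^sup>2 * k s' y'"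
    using second_difference_mvt[where f = "\<lambda>y s. f s y" and p = "\<lambda>y s. q s y"
        and g = "\<lambda>y s. k s y" and t = x and x = t, OF fq qk h] by blast
  have "h\<^sup>2 * g s y = h\<^sup>2 * k s' y'" using sy(5) sy'(5) by linarith
  then have eq: "g s y = k s' y'" using h by simp
  have "dist (g s y) (g t x) < e" "dist (k s' y') (k t x) < e"
    using d1(2)[of "(s, y)"] d2(2)[of "(s', y')"] near[OF sy(1-4)] near[OF sy'(3,4,1,2)] by auto
  then have "dist (g t x) (k t x) < 2 * e"
    unfolding eq dist_real_def by linarith
  then show False by (simp add: e_def)
qed

lemma C1_has_derivative_dt: "C1 f \<Longrightarrow> ((\<lambda>s. f s x) has_real_derivative dt f t x) (at t)"
  unfolding C1_def dt_def by (simp add: DERIV_deriv_iff_field_differentiable)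

lemma C1_has_derivative_dx: "C1 f \<Longrightarrow> (f t has_real_derivative dx f t x) (at x)"
  unfolding C1_def dx_def by (simp add: DERIV_deriv_iff_field_differentiable)

lemma dt_eqI: "((\<lambda>s. f s x) has_real_derivative D) (at t) \<Longrightarrow> dt f t x = D"
  unfolding dt_def by (rule DERIV_imp_deriv)

lemma dx_eqI: "(f t has_real_derivative D) (at x) \<Longrightarrow> dx f t x = D"
  unfolding dx_def by (rule DERIV_imp_deriv)

lemma dt_dx_commute:
  assumes "C2 f"
  shows "dt (dx f) t x = dx (dt f) t x"
proof -
  have C1: "C1 f" "C1 (dt f)" "C1 (dx f)" using assms by (auto simp: C2_def)
  have "isCont (\<lambda>(s, y). dx (dt f) s y) (t, x)" "isCont (\<lambda>(s, y). dt (dx f) s y) (t, x)"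
    using C1(2,3) by (auto simp: C1_def continuous_on_eq_continuous_at)
  then show ?thesis
    using mixed_partials_eq[where f = f and p = "dt f" and q = "dx f"
        and g = "dx (dt f)" and k = "dt (dx f)"]
      C1_has_derivative_dt C1_has_derivative_dx C1 by metis
qed

lemma L_2HS_partials:
  "L_u L_2HS = (\<lambda>u ut ux r rt rx. ux\<^sup>2 + rx\<^sup>2)"
  "L_ut L_2HS = (\<lambda>u ut ux r rt rx. ux)"
  "L_ux L_2HS = (\<lambda>u ut ux r rt rx. ut + 2 * u * ux)"
  "L_r L_2HS = (\<lambda>u ut ux r rt rx. 0)"
  "L_rt L_2HS = (\<lambda>u ut ux r rt rx. rx)"
  "L_rx L_2HS = (\<lambda>u ut ux r rt rx. rt + 2 * u * rx)"
  unfolding L_u_def L_ut_def L_ux_def L_r_def L_rt_def L_rx_def L_2HS_def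
  by (intro ext DERIV_imp_deriv; auto intro!: derivative_eq_intros)+

lemma EL_u_L_2HS:
  assumes u: "C2 u"
  shows "EL_u L_2HS u r t x =
    - 2 * (dx (\<lambda>t x. dt u t x + u t x * dx u t x) t x - (1/2 * (dx u t x)\<^sup>2 + 1/2 * (dx r t x)\<^sup>2))"
proof -
  have C1: "C1 u" "C1 (dt u)" "C1 (dx u)" using u by (auto simp: C2_def)
  note [derivative_intros] = C1_has_derivative_dx[OF C1(1)] C1_has_derivative_dx[OF C1(2)]
    C1_has_derivative_dx[OF C1(3)]
  have "dx (\<lambda>t x. dt u t x + 2 * u t x * dx u t x) t x
      = dx (dt u) t x + 2 * (dx u t x)\<^sup>2 + 2 * u t x * dx (dx u) t x"
    by (rule dx_eqI) (auto intro!: derivative_eq_intros simp: power2_eq_square)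
  moreover have "dx (\<lambda>t x. dt u t x + u t x * dx u t x) t x
      = dx (dt u) t x + (dx u t x)\<^sup>2 + u t x * dx (dx u) t x"
    by (rule dx_eqI) (auto intro!: derivative_eq_intros simp: power2_eq_square)
  ultimately show ?thesis
    by (simp add: EL_u_def along_def L_2HS_partials dt_dx_commute[OF u] algebra_simps)
qed

lemma EL_r_L_2HS:
  assumes u: "C2 u" and r: "C2 r"
  shows "EL_r L_2HS u r t x = - 2 * (dt (dx r) t x + dx (\<lambda>t x. u t x * dx r t x) t x)"
proof -
  have C1: "C1 u" "C1 (dt r)" "C1 (dx r)" using u r by (auto simp: C2_def)
  note [derivative_intros] = C1_has_derivative_dx[OF C1(1)] C1_has_derivative_dx[OF C1(2)]
    C1_has_derivative_dx[OF C1(3)]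
  have "dx (\<lambda>t x. dt r t x + 2 * u t x * dx r t x) t x
      = dx (dt r) t x + 2 * dx u t x * dx r t x + 2 * u t x * dx (dx r) t x"
    by (rule dx_eqI) (auto intro!: derivative_eq_intros)
  moreover have "dx (\<lambda>t x. u t x * dx r t x) t x = dx u t x * dx r t x + u t x * dx (dx r) t x"
    by (rule dx_eqI) (auto intro!: derivative_eq_intros)
  ultimately show ?thesis
    by (simp add: EL_r_def along_def L_2HS_partials dt_dx_commute[OF r] algebra_simps)
qed

theorem theorem2p4:
  shows "(\<exists>c d :: real. c \<noteq> 0 \<and> d \<noteq> 0 \<and>
           (\<forall>u r \<rho>. C2 u \<longrightarrow> C2 r \<longrightarrow> \<rho> = dx r \<longrightarrow>
             (\<forall>t x.
               EL_u L_2HS u r t x =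
                 c * (dx (\<lambda>t x. dt u t x + u t x * dx u t x) t x
                      - (1/2 * (dx u t x)\<^sup>2 + 1/2 * (\<rho> t x)\<^sup>2)) \<and>
               EL_r L_2HS u r t x =
                 d * (dt \<rho> t x + dx (\<lambda>t x. u t x * \<rho> t x) t x)))) \<and>
         (\<forall>u r \<rho>. C2 u \<longrightarrow> C2 r \<longrightarrow> \<rho> = dx r \<longrightarrow>
           (\<forall>t x.
             (EL_u L_2HS u r t x = 0 \<longleftrightarrow>
               dx (\<lambda>t x. dt u t x + u t x * dx u t x) t x
                 = 1/2 * (dx u t x)\<^sup>2 + 1/2 * (\<rho> t x)\<^sup>2) \<and>
             (EL_r L_2HS u r t x = 0 \<longleftrightarrow>
               dt \<rho> t x + dx (\<lambda>t x. u t x * \<rho> t x) t x = 0)))"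
proof (intro conjI)
  show "\<exists>c d :: real. c \<noteq> 0 \<and> d \<noteq> 0 \<and>
           (\<forall>u r \<rho>. C2 u \<longrightarrow> C2 r \<longrightarrow> \<rho> = dx r \<longrightarrow>
             (\<forall>t x.
               EL_u L_2HS u r t x =
                 c * (dx (\<lambda>t x. dt u t x + u t x * dx u t x) t x
                      - (1/2 * (dx u t x)\<^sup>2 + 1/2 * (\<rho> t x)\<^sup>2)) \<and>
               EL_r L_2HS u r t x =
                 d * (dt \<rho> t x + dx (\<lambda>t x. u t x * \<rho> t x) t x)))"
    by (rule exI[of _ "- 2"], rule exI[of _ "- 2"]) (simp add: EL_u_L_2HS EL_r_L_2HS)
qed (intro allI impI conjI; simp add: EL_u_L_2HS EL_r_L_2HS; argo)

end
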